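(* Fix an integer $k \geq 2$ and let $G$ be a finite simple vertex critical graph with $\chi(G) \geq \Delta(G) + 1 - k$. If $\Delta(G) + 1 \geq 6k$ and $\mathcal{H}(G)$ is edgeless, then $G = K_{\chi(G)}$.
   Context: A graph $G$ is vertex critical if $\chi(G - v) < \chi(G)$ for every vertex $v$. For $r \geq 0$, $G^{\geq r}$ denotes the subgraph of $G$ induced on the vertices of degree at least $r$ in $G$, and $\mathcal{H}(G) = G^{\geq \chi(G)}$. $\Delta(G)$ is the maximum degree and $\chi(G)$ the chromatic number. *)

theory Defs
  imports Main
begin

definition simple_graph :: "'a set \<Rightarrow> ('a \<Rightarrow> 'a \<Rightarrow> bool) \<Rightarrow> bool" where
  "simple_graph V E \<longleftrightarrow> finite V \<and> (\<forall>u v. E u v \<longrightarrow> u \<in> V \<and> v \<in> V)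
     \<and> (\<forall>u v. E u v \<longrightarrow> E v u) \<and> (\<forall>v. \<not> E v v)"

definition colouring :: "'a set \<Rightarrow> ('a \<Rightarrow> 'a \<Rightarrow> bool) \<Rightarrow> nat \<Rightarrow> ('a \<Rightarrow> nat) \<Rightarrow> bool" where
  "colouring V E k f \<longleftrightarrow> (\<forall>v\<in>V. f v < k) \<and> (\<forall>u\<in>V. \<forall>v\<in>V. E u v \<longrightarrow> f u \<noteq> f v)"

definition chromatic_number :: "'a set \<Rightarrow> ('a \<Rightarrow> 'a \<Rightarrow> bool) \<Rightarrow> nat" where
  "chromatic_number V E = (LEAST k. \<exists>f. colouring V E k f)"

definition vertex_critical :: "'a set \<Rightarrow> ('a \<Rightarrow> 'a \<Rightarrow> bool) \<Rightarrow> bool" where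
  "vertex_critical V E \<longleftrightarrow>
     (\<forall>v\<in>V. chromatic_number (V - {v}) E < chromatic_number V E)"

definition degree :: "'a set \<Rightarrow> ('a \<Rightarrow> 'a \<Rightarrow> bool) \<Rightarrow> 'a \<Rightarrow> nat" where
  "degree V E v = card {u\<in>V. E v u}"

definition max_degree :: "'a set \<Rightarrow> ('a \<Rightarrow> 'a \<Rightarrow> bool) \<Rightarrow> nat" where
  "max_degree V E = Max (insert 0 (degree V E ` V))"

definition high_vertices :: "'a set \<Rightarrow> ('a \<Rightarrow> 'a \<Rightarrow> bool) \<Rightarrow> nat \<Rightarrow> 'a set" where
  "high_vertices V E r = {v\<in>V. r \<le> degree V E v}"

definition edgeless_on :: "'a set \<Rightarrow> ('a \<Rightarrow> 'a \<Rightarrow> bool) \<Rightarrow> bool" where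
  "edgeless_on W E \<longleftrightarrow> (\<forall>u\<in>W. \<forall>v\<in>W. \<not> E u v)"

definition is_complete_graph :: "'a set \<Rightarrow> ('a \<Rightarrow> 'a \<Rightarrow> bool) \<Rightarrow> nat \<Rightarrow> bool" where
  "is_complete_graph V E n \<longleftrightarrow> card V = n \<and> (\<forall>u\<in>V. \<forall>v\<in>V. u \<noteq> v \<longrightarrow> E u v)"

end

theory Submission
  imports Defs
begin

text \<open>Put \<open>r = \<chi> - 1\<close> and call a vertex low if its degree is \<open>r\<close>; high vertices are pairwise
  nonadjacent. Write \<open>r\<close> as a sum of \<open>k + 1\<close> numbers \<open>q i \<ge> 3\<close> and take a partition of the vertices
  into \<open>k + 1\<close> parts that minimises Lovasz' weight and then the number of hot cliques, that is of
  cliques of size \<open>q i + 1\<close> inside part \<open>i\<close>. Since \<open>\<Delta> \<le> r + k\<close>, part \<open>i\<close> has maximum degree at most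
  \<open>q i\<close>, so by Brooks' theorem a hot clique exists, as otherwise \<open>r\<close> colours suffice. A low vertex of a
  hot clique can be moved to any other part without losing optimality, and then it completes a new
  hot clique there. Following such moves between two parts until they close up shows that any two
  vertices in the closed neighbourhood of a low vertex of a hot clique are adjacent unless both
  are high. Two high vertices there would allow an \<open>r\<close>-colouring, so this neighbourhood is a
  \<open>K\<^sub>r\<^sub>+\<^sub>1\<close>, and by criticality it is the whole graph.\<close>

section \<open>Brooks' theorem\<close>

definition clique :: "('a \<Rightarrow> 'a \<Rightarrow> bool) \<Rightarrow> 'a set \<Rightarrow> bool" where
  "clique E A \<longleftrightarrow> (\<forall>u\<in>A. \<forall>v\<in>A. u \<noteq> v \<longrightarrow> E u v)"

definition nbrs :: "('a \<Rightarrow> 'a \<Rightarrow> bool) \<Rightarrow> 'a set \<Rightarrow> 'a \<Rightarrow> 'a set" where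
  "nbrs E S v = {u \<in> S. E v u}"

lemma mem_nbrs [simp]: "u \<in> nbrs E S v \<longleftrightarrow> u \<in> S \<and> E v u"
  by (simp add: nbrs_def)

lemma finite_nbrs [simp]: "finite S \<Longrightarrow> finite (nbrs E S v)"
  by (simp add: nbrs_def)

lemma cliqueD: "clique E A \<Longrightarrow> u \<in> A \<Longrightarrow> v \<in> A \<Longrightarrow> u \<noteq> v \<Longrightarrow> E u v"
  by (simp add: clique_def)

lemma colouring_subset: "colouring V E k f \<Longrightarrow> S \<subseteq> V \<Longrightarrow> colouring S E k f"
  unfolding colouring_def by blast

locale sym_irrefl =
  fixes E :: "'a \<Rightarrow> 'a \<Rightarrow> bool"
  assumes E_sym: "E u v \<Longrightarrow> E v u"
    and E_irrefl: "\<not> E v v"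
begin

section \<open>Greedy extension of colourings\<close>

lemma colouring_insert:
  assumes "colouring S E k f" "a < k" "\<And>u. u \<in> S \<Longrightarrow> E v u \<Longrightarrow> f u \<noteq> a" "v \<notin> S"
  shows "colouring (insert v S) E k (f(v := a))"
  unfolding colouring_def
proof (intro conjI ballI impI)
  fix u assume "u \<in> insert v S"
  then show "(f(v := a)) u < k"
    using assms by (auto simp: colouring_def)
next
  fix u w assume "u \<in> insert v S" "w \<in> insert v S" "E u w"
  then show "(f(v := a)) u \<noteq> (f(v := a)) w"
    using assms E_irrefl E_sym[of u w] unfolding colouring_def by (auto; metis)
qed

lemma colouring_extend_vertex:
  assumes "colouring S E k f" "v \<notin> S" "finite S" "card (f ` nbrs E S v) < k"
  obtains g where "colouring (insert v S) E k g" "\<And>u. u \<in> S \<Longrightarrow> g u = f u"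
proof -
  have "\<not> {..<k} \<subseteq> f ` nbrs E S v"
    using assms card_mono[of "f ` nbrs E S v" "{..<k}"] by auto
  then obtain a where a: "a < k" "a \<notin> f ` nbrs E S v"
    by auto
  have "colouring (insert v S) E k (f(v := a))"
    using a assms by (intro colouring_insert) (auto simp: image_iff)
  moreover have "\<And>u. u \<in> S \<Longrightarrow> (f(v := a)) u = f u"
    using assms by auto
  ultimately show thesis
    using that by blast
qed

text \<open>Colour the path from its start: each vertex of \<open>xs\<close> still has its successor
  uncoloured, so at most \<open>k - 1\<close> of its neighbours are coloured. The end
  \<open>u\<close> only serves as the last successor and stays uncoloured.\<close>

lemma colouring_extend_path:
  assumes "colouring S E k f" "finite V" "S \<subseteq> V" "set (xs @ [u]) \<subseteq> V - S"
    and "distinct (xs @ [u])" "successively E (xs @ [u])"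
    and "\<And>v. v \<in> V \<Longrightarrow> card (nbrs E V v) \<le> k"
  shows "\<exists>g. colouring (S \<union> set xs) E k g \<and> (\<forall>v\<in>S. g v = f v)"
  using assms
proof (induction xs arbitrary: S f)
  case Nil
  then show ?case by auto
next
  case (Cons x xs)
  obtain y where y: "y \<in> set (xs @ [u])" "E x y"
    using Cons.prems(6) by (cases xs) auto
  have fin: "finite S"
    using Cons.prems finite_subset by blast
  have "y \<in> nbrs E V x - nbrs E S x"
    using y Cons.prems(4) by auto
  moreover have "nbrs E S x \<subseteq> nbrs E V x"
    using Cons.prems(3) by auto
  ultimately have "nbrs E S x \<subset> nbrs E V x"
    by blast
  then have "card (nbrs E S x) < k"
    using Cons.prems(2,4,7) psubset_card_mono[of "nbrs E V x" "nbrs E S x"]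
    by (metis (no_types, lifting) Diff_subset append_Cons finite_nbrs in_mono list.set_intros(1)
        order_less_le_trans)
  then have "card (f ` nbrs E S x) < k"
    using fin by (meson card_image_le finite_nbrs le_less_trans)
  moreover have "x \<notin> S"
    using Cons.prems(4) by auto
  ultimately obtain g where g: "colouring (insert x S) E k g" "\<And>u. u \<in> S \<Longrightarrow> g u = f u"
    using colouring_extend_vertex[OF Cons.prems(1)] fin by metis
  have "successively E (xs @ [u])"
    using Cons.prems(6) by (cases xs) auto
  then obtain h where "colouring (insert x S \<union> set xs) E k h" "\<forall>v\<in>insert x S. h v = g v"
    using Cons.IH[OF g(1)] Cons.prems by auto
  then show ?case
    using g(2) by (intro exI[of _ h]) auto
qed

text \<open>The end \<open>u\<close> may have \<open>k\<close> coloured neighbours, but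
  \<open>a\<close> and \<open>b\<close> share a colour, so one is left for \<open>u\<close>.\<close>

lemma colouring_extend_path_last:
  assumes "colouring S E k f" "finite V" "S \<subseteq> V" "set (xs @ [u]) \<subseteq> V - S"
    and "distinct (xs @ [u])" "successively E (xs @ [u])"
    and deg: "\<And>v. v \<in> V \<Longrightarrow> card (nbrs E V v) \<le> k"
    and ab: "a \<in> S" "b \<in> S" "a \<noteq> b" "E u a" "E u b" "f a = f b"
  shows "\<exists>g. colouring (insert u (S \<union> set xs)) E k g"
proof -
  obtain g where g: "colouring (S \<union> set xs) E k g" "\<forall>v\<in>S. g v = f v"
    using colouring_extend_path[OF assms(1-7)] by blast
  let ?N = "nbrs E (S \<union> set xs) u"
  have fin: "finite (S \<union> set xs)"
    using assms finite_subset by blast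
  have "\<not> inj_on g ?N"
    using ab g(2) unfolding inj_on_def by (metis UnI1 mem_nbrs)
  then have "card (g ` ?N) < card ?N"
    using fin by (meson card_image_le eq_card_imp_inj_on finite_nbrs nat_less_le)
  also have "card ?N \<le> card (nbrs E V u)"
    using assms(2,3,4) by (intro card_mono) auto
  also have "\<dots> \<le> k"
    using assms(4) deg by auto
  finally have *: "card (g ` ?N) < k" .
  have "u \<notin> S \<union> set xs"
    using assms(4,5) by auto
  then show ?thesis
    using colouring_extend_vertex[OF g(1) _ fin *] by metis
qed

text \<open>Take a longest extension of \<open>p\<close>: a neighbour of its end lying off the path
  could be appended.\<close>

lemma maximal_path:
  assumes "finite V" "set p \<subseteq> V" "distinct p" "successively E p" "p \<noteq> []"
  shows "\<exists>q. set (p @ q) \<subseteq> V \<and> distinct (p @ q) \<and> successively E (p @ q)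
    \<and> nbrs E V (last (p @ q)) \<subseteq> set (p @ q)"
proof -
  let ?P = "\<lambda>q. set (p @ q) \<subseteq> V \<and> distinct (p @ q) \<and> successively E (p @ q)"
  have "\<exists>q. ?P q \<and> (\<forall>q'. ?P q' \<longrightarrow> length q' \<le> length q)"
  proof (rule ex_has_greatest_nat[of _ "[]" _ "Suc (card V)"])
    show "?P []" using assms by simp
    show "\<forall>q. ?P q \<longrightarrow> length q < Suc (card V)"
      by (metis assms(1) card_mono distinct_append distinct_card le_sup_iff less_Suc_eq_le set_append)
  qed
  then obtain q where q: "?P q" "\<And>q'. ?P q' \<Longrightarrow> length q' \<le> length q"
    by blast
  have "nbrs E V (last (p @ q)) \<subseteq> set (p @ q)"
  proof (rule subsetI, rule ccontr)
    fix u assume u: "u \<in> nbrs E V (last (p @ q))" "u \<notin> set (p @ q)"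
    have "successively E ((p @ q) @ [u])"
      using q(1) u assms(5) by (subst successively_append_iff) auto
    then have "?P (q @ [u])"
      using q(1) u by auto
    then show False
      using q(2)[of "q @ [u]"] by simp
  qed
  then show ?thesis
    using q(1) by blast
qed

text \<open>Zajac's argument: walk along a path that cannot be prolonged, and colour greedily towards a
  vertex two of whose neighbours already share a colour.\<close>

theorem brooks:
  assumes "finite V" "k \<ge> 3"
    and "\<And>v. v \<in> V \<Longrightarrow> card (nbrs E V v) \<le> k"
    and "\<And>A. A \<subseteq> V \<Longrightarrow> clique E A \<Longrightarrow> card A \<noteq> k + 1"
  shows "\<exists>f. colouring V E k f"
  using assms(1,3,4)
proof (induction V rule: finite_psubset_induct)
  case (psubset V)
  note fin = \<open>finite V\<close> and deg = psubset.prems(1) and noclique = psubset.prems(2)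
  show ?case
  proof (rule ccontr)
    assume not_col: "\<nexists>f. colouring V E k f"
    have sub: "\<exists>f. colouring W E k f" if "W \<subset> V" for W
    proof (rule psubset.IH[OF that])
      fix v assume "v \<in> W"
      then have "card (nbrs E W v) \<le> card (nbrs E V v)" "v \<in> V"
        using that fin by (auto intro!: card_mono)
      then show "card (nbrs E W v) \<le> k"
        using deg le_trans by blast
    qed (use that noclique in blast)
    \<comment> \<open>A vertex with fewer than \<open>k\<close> neighbours could be coloured
      last.\<close>
    have reg: "card (nbrs E V v) = k" if v: "v \<in> V" for v
    proof (rule ccontr)
      assume "card (nbrs E V v) \<noteq> k"
      then have "card (nbrs E V v) < k"
        using deg v by (simp add: nat_less_le)
      moreover have "card (nbrs E (V - {v}) v) \<le> card (nbrs E V v)"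
        using fin by (intro card_mono) auto
      moreover obtain f where f: "colouring (V - {v}) E k f"
        using sub[of "V - {v}"] v by blast
      ultimately have "card (f ` nbrs E (V - {v}) v) < k"
        using fin by (meson card_image_le finite_Diff finite_nbrs le_less_trans)
      then obtain g where "colouring (insert v (V - {v})) E k g"
        using colouring_extend_vertex[OF f] fin by (metis Diff_iff finite_Diff singletonI)
      then show False
        using not_col v by (simp add: insert_absorb)
    qed
    have "V \<noteq> {}"
      using not_col by (auto simp: colouring_def)
    then obtain v where v: "v \<in> V" by blast
    have "card (insert v (nbrs E V v)) = k + 1"
      using fin reg[OF v] E_irrefl by simp
    then have "\<not> clique E (insert v (nbrs E V v))"
      using noclique v by (metis insert_subset mem_nbrs subsetI)
    then obtain x y where xy: "x \<in> V" "y \<in> V" "E v x" "E v y" "x \<noteq> y" "\<not> E x y"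
      unfolding clique_def using E_sym by auto
    \<comment> \<open>Starting with \<open>x\<close>, \<open>v\<close>, \<open>y\<close> lets the
      nonadjacent \<open>x\<close> and \<open>y\<close> share a colour, which later leaves one free
      for \<open>v\<close>.\<close>
    have "\<exists>q. set ([x,v,y] @ q) \<subseteq> V \<and> distinct ([x,v,y] @ q) \<and> successively E ([x,v,y] @ q)
        \<and> nbrs E V (last ([x,v,y] @ q)) \<subseteq> set ([x,v,y] @ q)"
      using xy v E_irrefl E_sym fin by (intro maximal_path) auto
    then obtain q where q: "set ([x,v,y] @ q) \<subseteq> V" "distinct ([x,v,y] @ q)"
        "successively E ([x,v,y] @ q)" "nbrs E V (last ([x,v,y] @ q)) \<subseteq> set ([x,v,y] @ q)"
      by blast
    define p where "p = [x,v,y] @ q"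
    define l where "l = last p"
    have p: "set p \<subseteq> V" "distinct p" "successively E p" "nbrs E V l \<subseteq> set p" "p \<noteq> []"
      using q by (simp_all only: p_def l_def) simp
    have l: "l \<in> V"
      using p l_def by auto
    have "nbrs E V l \<noteq> {}"
      using reg[OF l] assms(2) by auto
    then have "\<exists>b\<in>set p. E l b"
      using p(4) by fastforce
    then obtain ys b zs where split: "p = ys @ b # zs" "E l b" "\<forall>c\<in>set ys. \<not> E l c"
      using split_list_first_prop[of p "E l"] by blast
    \<comment> \<open>As \<open>b\<close> is the first neighbour of \<open>l\<close> on the path,
      the segment from \<open>b\<close> to \<open>l\<close> closes up to a cycle through all
      neighbours of \<open>l\<close>.\<close>
    define C where "C = b # zs"
    have C: "set C \<subseteq> V" "distinct C" "successively E C" "last C = l" "nbrs E V l \<subseteq> set C"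
      using p split by (auto simp: C_def l_def successively_append_iff)
    show False
    proof (cases "set C = V")
      case True
      \<comment> \<open>The path spans \<open>V\<close>. Colour \<open>x\<close> and
        \<open>y\<close> alike, go forward until just before a third neighbour \<open>u\<close> of
        \<open>v\<close>, then from the far end back to \<open>u\<close>, and finish with
        \<open>v\<close>.\<close>
      have "ys = []"
        using True p(1,2) by (cases ys) (auto simp: split C_def)
      then have V: "V = set ([x,v,y] @ q)"
        using True p_def split C_def by simp
      have "\<not> nbrs E V v \<subseteq> {x, y}"
        using reg[OF v] assms(2) card_mono[of "{x,y}" "nbrs E V v"] card_insert_le_m1[of 2 "{y}" x]
        by (auto simp: card_insert_if split: if_splits)
      then obtain u where u: "u \<in> V" "E v u" "u \<noteq> x" "u \<noteq> y"
        by (metis empty_iff insert_iff mem_nbrs subsetI)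
      then have "u \<in> set q"
        using V E_irrefl by auto
      then obtain q1 q2 where q12: "q = q1 @ u # q2"
        using split_list by metis
      have col0: "colouring {x,y} E k (\<lambda>_. 0)"
        using assms(2) xy E_irrefl E_sym by (auto simp: colouring_def)
      have "\<exists>g. colouring ({x,y} \<union> set q1) E k g \<and> (\<forall>v\<in>{x,y}. g v = 0)"
        using q q12 xy deg fin
        by (intro colouring_extend_path[OF col0, of V _ u])
          (auto simp: successively_append_iff successively_Cons)
      then obtain g where g: "colouring ({x,y} \<union> set q1) E k g" "g x = 0" "g y = 0"
        by auto
      have "successively E (v # u # q2)"
        using q(3) q12 u(2) by (auto simp: successively_append_iff successively_Cons)
      then have "successively (\<lambda>x y. E y x) (rev (v # u # q2))"
        by (simp only: successively_rev)
      then have succ: "successively E ((rev q2 @ [u]) @ [v])"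
        using E_sym by (auto elim!: successively_mono)
      have "\<exists>g. colouring (insert v (({x,y} \<union> set q1) \<union> set (rev q2 @ [u]))) E k g"
        using q q12 xy u v g
        by (intro colouring_extend_path_last[OF g(1) fin _ _ _ succ deg, of x y]) auto
      moreover have "insert v (({x,y} \<union> set q1) \<union> set (rev q2 @ [u])) = V"
        using V q12 by auto
      ultimately show False
        using not_col by simp
    next
      case False
      let ?out = "\<lambda>u. \<exists>w\<in>V - set C. E u w"
      obtain f where f: "colouring (V - set C) E k f"
        using sub[of "V - set C"] C(1) C_def by fastforce
      \<comment> \<open>Otherwise no edge leaves the cycle, and colourings of \<open>C\<close> and
        of its complement merge.\<close>
      have "\<exists>u\<in>set C. ?out u"
      proof (rule ccontr)
        assume *: "\<not> (\<exists>u\<in>set C. ?out u)"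
        obtain g where g: "colouring (set C) E k g"
          using sub[of "set C"] C(1) False by blast
        have "colouring V E k (\<lambda>u. if u \<in> set C then g u else f u)"
          using f g * E_sym unfolding colouring_def by (auto; blast)
        then show False
          using not_col by blast
      qed
      \<comment> \<open>The successor \<open>u'\<close> of this last \<open>u\<close> has no
        neighbour off the cycle, so it may take the colour of \<open>w\<close>. Going round the
        cycle from \<open>u'\<close> back to \<open>u\<close> then ends at a vertex that sees one
        colour twice.\<close>
      then obtain c1 u c2 where u: "C = c1 @ u # c2" "?out u" "\<forall>c\<in>set c2. \<not> ?out c"
        using split_list_last_prop[of C ?out] by blast
      obtain w where w: "w \<in> V" "w \<notin> set C" "E u w"
        using u(2) by blast
      have "u \<noteq> l"
        using w C(5) by auto
      then obtain u' c3 where c2: "c2 = u' # c3"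
        using C(4) u(1) by (cases c2) auto
      have u': "u' \<notin> V - set C" "E u u'"
        using C(3) u(1) c2 by (auto simp: successively_append_iff)
      have f': "colouring (insert u' (V - set C)) E k (f(u' := f w))"
        using f w u u' c2 by (intro colouring_insert) (auto simp: colouring_def)
      have "successively E c3" "successively E (c1 @ [u])"
        using C(3) u(1) c2 by (auto simp: successively_append_iff successively_Cons)
      \<comment> \<open>This is the closing edge from \<open>l\<close> to \<open>b\<close>.\<close>
      moreover have "c3 = [] \<or> E (last c3) (hd (c1 @ [u]))"
        using C(4) u(1) c2 split(2) C_def by (cases c1) (auto split: if_splits)
      ultimately have succ: "successively E ((c3 @ c1) @ [u])"
        by (simp add: successively_append_iff)
      have "\<exists>g. colouring (insert u (insert u' (V - set C) \<union> set (c3 @ c1))) E k g"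
        using C(1,2) u(1) c2 w u'
        by (intro colouring_extend_path_last[OF f' fin _ _ _ succ deg, of w u']) (auto simp: E_irrefl)
      moreover have "insert u (insert u' (V - set C) \<union> set (c3 @ c1)) = V"
        using C(1) u(1) c2 by auto
      ultimately show False
        using not_col by simp
    qed
  qed
qed

end

section \<open>Optimal partitions\<close>

text \<open>\<open>r\<close> stands for the chromatic number minus one, and the indices up to
  \<open>k\<close> give \<open>k + 1\<close> parts. The bound 3 on \<open>q i\<close> is the one
  Brooks' theorem asks for, and it gives hot cliques at least four vertices.\<close>

locale critical_partition = sym_irrefl E
  for E :: "'a \<Rightarrow> 'a \<Rightarrow> bool" +
  fixes V :: "'a set" and r k :: nat and q :: "nat \<Rightarrow> nat"
  assumes fin: "finite V"
    and not_colourable: "\<not> colouring V E r f"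
    and vertex_deleted: "v \<in> V \<Longrightarrow> \<exists>f. colouring (V - {v}) E r f"
    and degree_le: "v \<in> V \<Longrightarrow> card (nbrs E V v) \<le> r + k"
    and high_indep: "u \<in> V \<Longrightarrow> v \<in> V \<Longrightarrow> E u v \<Longrightarrow>
      card (nbrs E V u) \<le> r \<or> card (nbrs E V v) \<le> r"
    and q_ge: "i \<le> k \<Longrightarrow> q i \<ge> 3"
    and q_sum: "(\<Sum>i\<le>k. q i) = r"
begin

definition low :: "'a \<Rightarrow> bool" where
  "low v \<longleftrightarrow> v \<in> V \<and> card (nbrs E V v) = r"

lemma degree_ge:
  assumes "v \<in> V"
  shows "r \<le> card (nbrs E V v)"
proof (rule ccontr)
  assume "\<not> r \<le> card (nbrs E V v)"
  moreover have "card (nbrs E (V - {v}) v) \<le> card (nbrs E V v)"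
    using fin by (intro card_mono) auto
  moreover obtain f where f: "colouring (V - {v}) E r f"
    using vertex_deleted[OF assms] by blast
  ultimately have "card (f ` nbrs E (V - {v}) v) < r"
    using fin by (meson card_image_le finite_Diff finite_nbrs le_less_trans not_le)
  then obtain g where "colouring (insert v (V - {v})) E r g"
    using colouring_extend_vertex[OF f] fin by (metis Diff_iff finite_Diff singletonI)
  then show False
    using not_colourable assms by (simp add: insert_absorb)
qed

lemma adjacent_low: "u \<in> V \<Longrightarrow> v \<in> V \<Longrightarrow> E u v \<Longrightarrow> low u \<or> low v"
  using high_indep degree_ge unfolding low_def by (metis le_antisym)

section \<open>Lovasz' weight and its minimisers\<close>

definition part :: "('a \<Rightarrow> nat) \<Rightarrow> nat \<Rightarrow> 'a set" where
  "part c i = {v \<in> V. c v = i}"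

lemma mem_part [simp]: "v \<in> part c i \<longleftrightarrow> v \<in> V \<and> c v = i"
  by (simp add: part_def)

lemma finite_part [simp]: "finite (part c i)"
  using fin by (simp add: part_def)

definition deg :: "('a \<Rightarrow> nat) \<Rightarrow> 'a \<Rightarrow> nat \<Rightarrow> nat" where
  "deg c v i = card (nbrs E (part c i) v)"

definition is_partition :: "('a \<Rightarrow> nat) \<Rightarrow> bool" where
  "is_partition c \<longleftrightarrow> (\<forall>v\<in>V. c v \<le> k)"

lemma sum_deg:
  assumes "is_partition c"
  shows "(\<Sum>i\<le>k. deg c v i) = card (nbrs E V v)"
proof -
  have "nbrs E V v = (\<Union>i\<le>k. nbrs E (part c i) v)"
    using assms by (auto simp: is_partition_def)
  then show ?thesis
    unfolding deg_def by (simp only:) (rule card_UN_disjoint[symmetric]; auto)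
qed

text \<open>Twice Lovasz' weight, up to a constant: \<open>r\<close> is only there to avoid negative summands
  (every \<open>q i\<close> with \<open>i \<le> k\<close> is at most \<open>r\<close>), and each edge inside a part counts twice.\<close>

definition pot :: "('a \<Rightarrow> nat) \<Rightarrow> nat" where
  "pot c = (\<Sum>u\<in>V. \<Sum>w\<in>V. of_bool (E u w \<and> c u = c w)) + 2 * (\<Sum>u\<in>V. r - q (c u))"

definition hot :: "('a \<Rightarrow> nat) \<Rightarrow> 'a set \<Rightarrow> bool" where
  "hot c A \<longleftrightarrow> A \<subseteq> V \<and> clique E A \<and> (\<exists>i\<le>k. card A = q i + 1 \<and> (\<forall>a\<in>A. c a = i))"

definition hots :: "('a \<Rightarrow> nat) \<Rightarrow> 'a set set" where
  "hots c = {A. hot c A}"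

definition optimal :: "('a \<Rightarrow> nat) \<Rightarrow> bool" where
  "optimal c \<longleftrightarrow> is_partition c \<and> (\<forall>c'. is_partition c' \<longrightarrow> pot c \<le> pot c')
     \<and> (\<forall>c'. is_partition c' \<longrightarrow> pot c' = pot c \<longrightarrow> card (hots c) \<le> card (hots c'))"

lemma finite_hots: "finite (hots c)"
  by (rule finite_subset[of _ "Pow V"]) (auto simp: hots_def hot_def fin)

lemma ex_optimal: "\<exists>c. optimal c"
proof -
  have "is_partition (\<lambda>_. 0)"
    by (simp add: is_partition_def)
  then obtain c where c: "is_partition c" "\<And>c'. is_partition c' \<Longrightarrow> pot c \<le> pot c'"
    using ex_has_least_nat[of is_partition _ pot] by blast
  then obtain d where d: "is_partition d" "pot d = pot c"
      "\<And>c'. is_partition c' \<Longrightarrow> pot c' = pot c \<Longrightarrow> card (hots d) \<le> card (hots c')"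
    using ex_has_least_nat[of "\<lambda>c'. is_partition c' \<and> pot c' = pot c" c "\<lambda>c. card (hots c)"]
    by blast
  then show ?thesis
    unfolding optimal_def using c by metis
qed

text \<open>Halved, the weight loses the excess \<open>deg - q\<close> of \<open>v\<close> in its
  old part and gains that in the new part. The additive form avoids truncated subtraction.\<close>

lemma pot_move:
  assumes "v \<in> V" "c v \<le> k" "j \<le> k" "j \<noteq> c v"
  shows "pot (c(v := j)) + 2 * deg c v (c v) + 2 * q j = pot c + 2 * deg c v j + 2 * q (c v)"
proof -
  let ?c' = "c(v := j)"
  let ?W = "V - {v}"
  have q_le: "q i \<le> r" if "i \<le> k" for i
    using that member_le_sum[of i "{..k}" q] q_sum by simp
  \<comment> \<open>Row and column of \<open>v\<close> are split off from the sum over ordered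
    pairs; they contribute equally.\<close>
  have edges: "(\<Sum>u\<in>V. \<Sum>w\<in>V. of_bool (E u w \<and> d u = d w)) =
     (\<Sum>u\<in>?W. \<Sum>w\<in>?W. of_bool (E u w \<and> d u = d w)) + 2 * card (nbrs E (part d (d v)) v)"
    (is "?l d = ?m d + _") for d :: "'a \<Rightarrow> nat"
  proof -
    have row: "(\<Sum>w\<in>V. of_bool (E v w \<and> d v = d w)) = card (nbrs E (part d (d v)) v)"
      using fin by (auto intro!: arg_cong[where f = card])
    have row': "(\<Sum>w\<in>?W. of_bool (E w v \<and> d w = d v)) = card (nbrs E (part d (d v)) v)"
      using fin E_irrefl E_sym by (auto intro!: arg_cong[where f = card])
    have "?l d = (\<Sum>w\<in>V. of_bool (E v w \<and> d v = d w))
        + (\<Sum>u\<in>?W. \<Sum>w\<in>V. of_bool (E u w \<and> d u = d w))"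
      using fin assms(1) by (rule sum.remove)
    also have "(\<Sum>u\<in>?W. \<Sum>w\<in>V. of_bool (E u w \<and> d u = d w)) =
        (\<Sum>u\<in>?W. of_bool (E u v \<and> d u = d v) + (\<Sum>w\<in>?W. of_bool (E u w \<and> d u = d w)))"
      by (intro sum.cong refl sum.remove fin assms(1))
    finally show ?thesis
      by (simp add: sum.distrib row row')
  qed
  have "part ?c' j = insert v (part c j)"
    using assms by (auto split: if_splits)
  then have "nbrs E (part ?c' (?c' v)) v = nbrs E (part c j) v"
    by (auto simp: E_irrefl)
  moreover have "?m ?c' = ?m c"
    by (intro sum.cong) auto
  moreover have "(\<Sum>u\<in>V. r - q (d u)) = (r - q (d v)) + (\<Sum>u\<in>?W. r - q (d u))"
    for d :: "'a \<Rightarrow> nat"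
    using fin assms(1) by (rule sum.remove)
  moreover have "(\<Sum>u\<in>?W. r - q (?c' u)) = (\<Sum>u\<in>?W. r - q (c u))"
    by (intro sum.cong) auto
  ultimately show ?thesis
    unfolding pot_def deg_def edges using q_le[OF assms(2)] q_le[OF assms(3)]
    by (simp del: fun_upd_apply add: fun_upd_same)
qed

lemma is_partition_move: "is_partition c \<Longrightarrow> j \<le> k \<Longrightarrow> is_partition (c(v := j))"
  by (simp add: is_partition_def)

text \<open>If the excess of \<open>v\<close> is positive in its own part, minimality makes it
  positive in all \<open>k + 1\<close> parts, so \<open>v\<close> has degree at least
  \<open>r + k + 1\<close>.\<close>

lemma optimal_deg_le:
  assumes "optimal c" "v \<in> V"
  shows "deg c v (c v) \<le> q (c v)"
proof (rule ccontr)
  assume gt: "\<not> deg c v (c v) \<le> q (c v)"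
  have c: "is_partition c" "c v \<le> k"
    using assms by (auto simp: optimal_def is_partition_def)
  have "q i + 1 \<le> deg c v i" if i: "i \<le> k" for i
  proof (cases "i = c v")
    case False
    have "pot c \<le> pot (c(v := i))"
      using assms(1) is_partition_move[OF c(1) i] by (simp add: optimal_def)
    then show ?thesis
      using pot_move[of v c i, OF assms(2) c(2) i False] gt by linarith
  qed (use gt in simp)
  then have "(\<Sum>i\<le>k. q i + 1) \<le> (\<Sum>i\<le>k. deg c v i)"
    by (intro sum_mono) auto
  then show False
    using sum_deg[OF c(1), of v] degree_le[OF assms(2)]
    unfolding sum.distrib q_sum by simp
qed

text \<open>The parts use disjoint blocks of colours, block \<open>i\<close> having length
  \<open>q i\<close>.\<close>

lemma combine_colourings:
  assumes "is_partition c" "\<And>i. i \<le> k \<Longrightarrow> colouring (part c i) E (q i) (f i)"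
  shows "colouring V E r (\<lambda>v. (\<Sum>i<c v. q i) + f (c v) v)"
proof -
  have lt: "f (c v) v < q (c v)" if "v \<in> V" for v
    using assms that by (auto simp: colouring_def is_partition_def)
  have le: "(\<Sum>i<c v. q i) + f (c v) v < (\<Sum>i<m. q i)" if "v \<in> V" "c v < m" for v m
  proof -
    have "(\<Sum>i<c v. q i) + f (c v) v < (\<Sum>i<Suc (c v). q i)"
      using lt[OF that(1)] by simp
    also have "\<dots> \<le> (\<Sum>i<m. q i)"
      using that(2) by (intro sum_mono2) auto
    finally show ?thesis .
  qed
  show ?thesis
    unfolding colouring_def
  proof (intro conjI ballI impI)
    fix v assume v: "v \<in> V"
    then show "(\<Sum>i<c v. q i) + f (c v) v < r"
      using le[OF v, of "Suc k"] assms(1) q_sum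
      by (simp add: is_partition_def less_Suc_eq_le lessThan_Suc_atMost)
  next
    fix u v assume uv: "u \<in> V" "v \<in> V" "E u v"
    show "(\<Sum>i<c u. q i) + f (c u) u \<noteq> (\<Sum>i<c v. q i) + f (c v) v"
    proof (cases "c u = c v")
      case True
      have "colouring (part c (c v)) E (q (c v)) (f (c v))"
        using assms uv by (auto simp: is_partition_def)
      then show ?thesis
        using uv True by (auto simp: colouring_def)
    next
      case False
      then show ?thesis
        using le[OF uv(1), of "c v"] le[OF uv(2), of "c u"] by linarith
    qed
  qed
qed

lemma ex_hot:
  assumes "optimal c"
  shows "\<exists>A. hot c A"
proof (rule ccontr)
  assume none: "\<nexists>A. hot c A"
  have c: "is_partition c"
    using assms by (simp add: optimal_def)
  have "\<exists>f. colouring (part c i) E (q i) f" if i: "i \<le> k" for i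
  proof (rule brooks)
    show "card (nbrs E (part c i) v) \<le> q i" if "v \<in> part c i" for v
      using optimal_deg_le[OF assms, of v] that by (auto simp: deg_def)
    show "card A \<noteq> q i + 1" if "A \<subseteq> part c i" "clique E A" for A
      using none that i unfolding hot_def by (metis mem_part subset_iff)
  qed (use q_ge i in auto)
  then obtain f where "\<And>i. i \<le> k \<Longrightarrow> colouring (part c i) E (q i) (f i)"
    by metis
  then show False
    using combine_colourings[OF c] not_colourable by blast
qed

section \<open>Hot cliques as components of their parts\<close>

definition closed_nbhd :: "('a \<Rightarrow> nat) \<Rightarrow> 'a \<Rightarrow> 'a set" where
  "closed_nbhd c x = insert x (nbrs E (part c (c x)) x)"

lemma mem_closed_nbhd: "v \<in> closed_nbhd c x \<longleftrightarrow> v = x \<or> v \<in> V \<and> c v = c x \<and> E x v"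
  by (auto simp: closed_nbhd_def)

lemma self_closed_nbhd [simp]: "x \<in> closed_nbhd c x"
  by (simp add: closed_nbhd_def)

lemma card_closed_nbhd: "card (closed_nbhd c x) = Suc (deg c x (c x))"
  by (simp add: closed_nbhd_def deg_def E_irrefl)

text \<open>The clique already uses up the degree that \<open>x\<close> may have in its part. Hence
  a hot clique is a component of its part and is determined by any of its vertices.\<close>

lemma hot_eq_closed_nbhd:
  assumes "optimal c" "hot c A" "x \<in> A"
  shows "A = closed_nbhd c x"
proof (rule card_seteq)
  have "x \<in> V" "card A = q (c x) + 1"
    using assms by (auto simp: hot_def)
  then show "card (closed_nbhd c x) \<le> card A"
    using optimal_deg_le[OF assms(1), of x] by (simp add: card_closed_nbhd)
  show "A \<subseteq> closed_nbhd c x"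
    using assms by (auto simp: hot_def mem_closed_nbhd clique_def)
  show "finite (closed_nbhd c x)"
    by (simp add: closed_nbhd_def)
qed

lemma hot_deg: "optimal c \<Longrightarrow> hot c A \<Longrightarrow> x \<in> A \<Longrightarrow> deg c x (c x) = q (c x)"
  using hot_eq_closed_nbhd[of c A x] card_closed_nbhd[of c x] by (auto simp: hot_def)

lemma hot_closed:
  assumes "optimal c" "hot c A" "a \<in> A" "u \<in> V" "E a u" "c u = c a"
  shows "u \<in> A"
  using hot_eq_closed_nbhd[OF assms(1,2,3)] assms by (simp add: mem_closed_nbhd)

text \<open>Minimality of the weight gives at least \<open>q i\<close> neighbours in each part
  \<open>i\<close>; these bounds add up to \<open>r\<close>, the degree of \<open>x\<close>, so all
  are equalities.\<close>

lemma low_deg_other: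
  assumes c: "optimal c" "hot c A" and x: "x \<in> A" "low x" and j: "j \<le> k"
  shows "deg c x j = q j"
proof (rule ccontr)
  assume ne: "deg c x j \<noteq> q j"
  have x': "x \<in> V" "is_partition c" "c x \<le> k"
    using c x by (auto simp: low_def optimal_def is_partition_def)
  have ge: "q i \<le> deg c x i" if "i \<le> k" for i
  proof (cases "i = c x")
    case False
    have "pot c \<le> pot (c(x := i))"
      using c(1) is_partition_move[OF x'(2) that] by (simp add: optimal_def)
    then show ?thesis
      using pot_move[of x c i, OF x'(1,3) that False] hot_deg[OF c x(1)] by linarith
  qed (use hot_deg[OF c x(1)] in simp)
  have "(\<Sum>i\<le>k. q i) < (\<Sum>i\<le>k. deg c x i)"
    using ge j ne by (intro sum_strict_mono_ex1) (auto simp: nat_less_le intro!: bexI[of _ j])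
  then show False
    using sum_deg[OF x'(2)] x(2) q_sum by (simp add: low_def)
qed

text \<open>The excess of \<open>x\<close> is zero everywhere, so the weight is unchanged. The move
  destroys \<open>A\<close>, and minimality of the number of hot cliques forces a new one, which
  must contain \<open>x\<close>.\<close>

lemma move:
  assumes c: "optimal c" "hot c A" and x: "x \<in> A" "low x" and j: "j \<le> k" "j \<noteq> c x"
  shows "optimal (c(x := j))" "hot (c(x := j)) (closed_nbhd (c(x := j)) x)"
proof -
  let ?c' = "c(x := j)"
  have x': "x \<in> V" "is_partition c" "c x \<le> k"
    using c x by (auto simp: low_def optimal_def is_partition_def)
  have part': "is_partition ?c'"
    using is_partition_move x' j by blast
  have pot: "pot ?c' = pot c"
    using pot_move[of x c j, OF x'(1,3) j] hot_deg[OF c x(1)] low_deg_other[OF c x j(1)] by simp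
  have le: "card (hots c) \<le> card (hots ?c')"
    using c(1) part' pot by (simp add: optimal_def)
  have old: "hot ?c' B \<longleftrightarrow> hot c B" if "x \<notin> B" for B
    using that unfolding hot_def by (metis fun_upd_other)
  have "\<exists>B. hot ?c' B \<and> x \<in> B"
  proof (rule ccontr)
    assume "\<nexists>B. hot ?c' B \<and> x \<in> B"
    then have "hots ?c' \<subseteq> hots c - {A}"
      using old x(1) by (auto simp: hots_def)
    then have "card (hots ?c') \<le> card (hots c - {A})"
      using finite_hots by (intro card_mono) auto
    also have "\<dots> < card (hots c)"
      using finite_hots c(2) by (intro card_Diff1_less) (auto simp: hots_def)
    finally show False
      using le by simp
  qed
  then obtain B where B: "hot ?c' B" "x \<in> B" by blast
  \<comment> \<open>Only one new hot clique can arise, so the number of hot cliques does not grow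
    either.\<close>
  have uniq: "D = closed_nbhd ?c' x" if D: "hot ?c' D" "x \<in> D" for D
  proof (rule card_seteq)
    have "card D = q j + 1"
      using D by (auto simp: hot_def)
    moreover have "nbrs E (part ?c' j) x = nbrs E (part c j) x"
      by (auto simp: E_irrefl split: if_splits)
    then have "deg ?c' x (?c' x) = deg c x j"
      by (simp add: deg_def)
    ultimately show "card (closed_nbhd ?c' x) \<le> card D"
      using low_deg_other[OF c x j(1)] by (simp add: card_closed_nbhd del: fun_upd_apply)
    show "D \<subseteq> closed_nbhd ?c' x"
      using D unfolding hot_def mem_closed_nbhd clique_def subset_iff by metis
    show "finite (closed_nbhd ?c' x)"
      by (simp add: closed_nbhd_def)
  qed
  show "hot ?c' (closed_nbhd ?c' x)"
    using B uniq by blast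
  have "hots ?c' \<subseteq> insert B (hots c - {A})"
    using old uniq B x(1) by (auto simp: hots_def)
  then have "card (hots ?c') \<le> card (insert B (hots c - {A}))"
    using finite_hots by (intro card_mono) auto
  also have "\<dots> \<le> Suc (card (hots c - {A}))"
    by (rule card_insert_le_m1) auto
  also have "\<dots> = card (hots c)"
    using finite_hots c(2) by (intro card_Suc_Diff1) (auto simp: hots_def)
  finally have "card (hots ?c') = card (hots c)"
    using le by simp
  then show "optimal ?c'"
    using c(1) part' pot by (simp add: optimal_def)
qed

subsection \<open>Moving low vertices of hot cliques\<close>

text \<open>Without \<open>y\<close> at least two vertices remain, and of two adjacent vertices one
  is low. This keeps the moves going: some low vertex other than the latest arrival can
  leave.\<close>

lemma hot_other_low:
  assumes "hot c A"
  shows "\<exists>a\<in>A. low a \<and> a \<noteq> y"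
proof -
  obtain i where i: "i \<le> k" "card A = q i + 1"
    using assms by (auto simp: hot_def)
  have "finite A"
    using assms fin finite_subset by (auto simp: hot_def)
  then have "\<not> card (A - {y}) \<le> Suc 0"
    using i q_ge[OF i(1)] by (simp add: card_Diff_singleton_if)
  then obtain a b where ab: "a \<in> A - {y}" "b \<in> A - {y}" "a \<noteq> b"
    using \<open>finite A\<close> by (metis card_le_Suc0_iff_eq finite_Diff)
  then have "E a b" "a \<in> V" "b \<in> V"
    using assms by (auto simp: hot_def clique_def)
  then show ?thesis
    using adjacent_low ab by blast
qed

text \<open>After moving \<open>p\<close> to part \<open>j\<close>, its neighbours there lie in one
  hot clique.\<close>

lemma low_nbrs_clique:
  assumes c: "optimal c" "hot c A" and p: "p \<in> A" "low p" and "j \<le> k" "j \<noteq> c p"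
    and "u \<in> V" "c u = j" "E p u" "v \<in> V" "c v = j" "E p v" "u \<noteq> v"
  shows "E u v"
proof -
  let ?c' = "c(p := j)"
  have "clique E (closed_nbhd ?c' p)"
    using move[OF c p assms(5,6)] by (simp add: hot_def)
  moreover have "u \<in> closed_nbhd ?c' p" "v \<in> closed_nbhd ?c' p"
    using assms by (auto simp: mem_closed_nbhd)
  ultimately show ?thesis
    using assms(13) by (simp add: clique_def)
qed

text \<open>After the same move the hot clique of \<open>p\<close> is a component of part
  \<open>j\<close>, so it contains \<open>v\<close> along with \<open>u\<close>.\<close>

lemma low_nbrs_closed:
  assumes c: "optimal c" "hot c A" and p: "p \<in> A" "low p" and "j \<le> k" "j \<noteq> c p"
    and "u \<in> V" "c u = j" "E p u" "v \<in> V" "c v = j" "E u v"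
  shows "E p v"
proof -
  let ?c' = "c(p := j)"
  have "u \<in> closed_nbhd ?c' p" "?c' v = ?c' u"
    using assms by (auto simp: mem_closed_nbhd)
  then have "v \<in> closed_nbhd ?c' p"
    using hot_closed[OF move[OF c p assms(5,6)]] assms by blast
  then show ?thesis
    using assms(6,11) by (auto simp: mem_closed_nbhd)
qed

text \<open>Keep moving low vertices of the hot clique back and forth between two parts, never the one
  that has just arrived. At the first time that an earlier arrival lies in the hot clique, this
  arrival must be the initial one and the clique must be the one left at the start.\<close>

lemma walk_returns:
  fixes d :: "nat \<Rightarrow> 'a \<Rightarrow> nat" and y :: "nat \<Rightarrow> 'a"
  assumes ij: "i \<le> k" "j \<le> k" "i \<noteq> j"
    and opt: "\<And>n. optimal (d n)"
    and hot: "\<And>n. hot (d n) (closed_nbhd (d n) (y n))"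
    and low: "\<And>n. low (y n)"
    and side: "\<And>n. d n (y n) \<in> {i, j}"
    and mem: "\<And>n. y (Suc n) \<in> closed_nbhd (d n) (y n)"
    and ne: "\<And>n. y (Suc n) \<noteq> y n"
    and step: "\<And>n. d (Suc n) = (d n)(y (Suc n) := (if d n (y n) = i then j else i))"
  shows "y 0 \<in> closed_nbhd (d (Suc (Suc 0))) (y (Suc (Suc 0)))"
proof -
  define H where "H n = closed_nbhd (d n) (y n)" for n
  have HV: "v \<in> V" if "v \<in> H n" for v n
    using hot[of n] that by (auto simp: H_def hot_def)
  have yH: "y n \<in> H n" "y (Suc n) \<in> H n" for n
    using mem by (simp_all add: H_def)
  have yV: "y n \<in> V" for n
    using yH HV by blast
  have H_side: "d n v = d n (y n)" if "v \<in> H n" for v n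
    using that by (auto simp: H_def mem_closed_nbhd)
  have H_adj: "E u v" if "u \<in> H n" "v \<in> H n" "u \<noteq> v" for u v n
    using hot[of n] that by (auto simp: H_def hot_def clique_def)
  have H_closed: "u \<in> H n" if "a \<in> H n" "u \<in> V" "E a u" "d n u = d n a" for a u n
    using hot_closed[OF opt hot] that unfolding H_def by blast
  have unmoved: "d (Suc n) v = d n v" if "v \<noteq> y (Suc n)" for n v
    using that step[of n] by simp
  have side_le: "d n (y n) \<le> k" for n
    using side[of n] ij by auto
  have flip: "d (Suc n) (y (Suc n)) \<noteq> d n (y n)" for n
    using step[of n] side[of n] ij by auto
  have flip2: "d (Suc (Suc n)) (y (Suc (Suc n))) = d n (y n)" for n
    using flip[of n] flip[of "Suc n"] side[of n] side[of "Suc n"] side[of "Suc (Suc n)"] by auto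
  have "\<not> inj y"
    using yV fin by (metis finite_imageD finite_subset image_subsetI infinite_UNIV_nat)
  then have "\<exists>n m. m < n \<and> y m = y n"
    unfolding inj_def by (metis linorder_neqE_nat)
  then have "\<exists>n. \<exists>m<n. y m \<in> H n"
    using yH(1) by metis
  then obtain N where N: "\<exists>m<N. y m \<in> H N" "\<And>l m. l < N \<Longrightarrow> m < l \<Longrightarrow> y m \<notin> H l"
    unfolding exists_least_iff[of "\<lambda>n. \<exists>m<n. y m \<in> H n"] by blast
  then obtain m where m: "m < N" "y m \<in> H N"
    by blast
  \<comment> \<open>Before time \<open>N\<close> no other vertex of \<open>H a\<close> moves: at the
    moment it left, the hot clique would contain the earlier arrival \<open>y a\<close>, against the
    choice of \<open>N\<close>.\<close>
  have stay: "d l v = d a v" if "Suc a \<le> l" "l \<le> N" "v \<in> H a" "v \<noteq> y (Suc a)" for a l v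
    using that
  proof (induction l arbitrary: v rule: dec_induct)
    case base
    then show ?case by (simp add: unmoved)
  next
    case (step l)
    have "v \<noteq> y (Suc l)"
    proof
      assume v: "v = y (Suc l)"
      have "d l v = d a v" "d l (y a) = d a (y a)"
        using step yH ne[of a] by auto
      then have "d l (y a) = d l v"
        using H_side step by simp
      moreover have "v \<in> H l"
        using v yH by simp
      moreover have "v = y a \<or> E v (y a)"
        using H_adj step yH by blast
      ultimately have "y a \<in> H l"
        using H_closed yV by metis
      then show False
        using N(2)[of l a] step by simp
    qed
    then show ?case
      using step unmoved[of v l] by simp
  qed
  define a where "a = Suc m"
  define t where "t = d m (y m)"
  define t' where "t' = d a (y a)"
  have t: "t' \<noteq> t" "t' \<le> k" "t \<le> k"
    using flip[of m] side_le[of m] side_le[of a] by (auto simp: a_def t_def t'_def)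
  have yam: "y a \<noteq> y m" "y a \<in> H m"
    using ne yH by (auto simp: a_def)
  have dam: "d a (y m) = t"
    using unmoved[of "y m" m] yam by (simp add: a_def t_def)
  have "y m \<notin> H a"
    using H_side[of "y m" a] dam t by (auto simp: t'_def)
  then have aN: "a < N"
    using m by (cases "a = N") (auto simp: a_def)
  have "card (H a - {y a, y (Suc a)}) \<noteq> 0"
  proof -
    have "card (H a) \<ge> 4"
      using hot[of a] q_ge unfolding H_def hot_def by fastforce
    moreover have "card (H a - {y a, y (Suc a)}) \<ge> card (H a) - card {y a, y (Suc a)}"
      by (intro diff_card_le_card_Diff) auto
    moreover have "card {y a, y (Suc a)} \<le> 2"
      by (simp add: card_insert_if)
    ultimately show ?thesis by linarith
  qed
  \<comment> \<open>A vertex of \<open>H a\<close> that neither arrived last nor leaves next; it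
    transfers information between the times \<open>m\<close> and \<open>N\<close>.\<close>
  then obtain v where v: "v \<in> H a" "v \<noteq> y a" "v \<noteq> y (Suc a)"
    by (metis Diff_iff card.empty equals0I insertCI)
  have at_N: "d N (y a) = t'" "d N v = t'" "d N (y m) = t"
    using stay[of a N "y a"] stay[of a N v] stay[of m N "y m"] aN v yH
      ne[of a] ne[of m] H_side[of v a]
    by (auto simp: t_def t'_def a_def)
  have ya: "E (y m) (y a)"
    using H_adj[of "y m" m "y a"] yam yH by metis
  have hotH: "hot (d n) (H n)" for n
    using hot by (simp add: H_def)
  \<comment> \<open>At time \<open>N\<close> the low vertex \<open>y m\<close> is again in a hot
    clique, so its neighbour \<open>y a\<close> in the other part brings \<open>v\<close>
    along.\<close>
  have yv: "E (y m) v"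
    using low_nbrs_closed[OF opt hotH m(2) low t(2), of "y a" v] at_N t ya yV HV v
      H_adj[OF yH(1) v(1)] by metis
  have ma: "d m u = t'" if "u \<in> H a" "u \<noteq> y a" for u
    using that unmoved[of u m] H_side[of u a] by (simp add: a_def t'_def)
  \<comment> \<open>Back at time \<open>m\<close>, \<open>v\<close> in turn brings along
    \<open>y (Suc a)\<close>, which then joins \<open>y m\<close> in its part.\<close>
  have yy: "E (y m) (y (Suc a))"
    using low_nbrs_closed[OF opt hotH yH(1) low t(2), of m v "y (Suc a)"] t yv yV HV v
      H_adj[OF v(1) yH(2) v(3)] ma[of v] ma[of "y (Suc a)"] yH(2)[of a] ne[of a]
    by (simp add: t_def)
  have "y m \<noteq> y (Suc a)"
    using yy E_irrefl by metis
  then have "d (Suc a) (y (Suc a)) = t" "d (Suc a) (y m) = t"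
    using flip2[of m] unmoved[of "y m" a] dam by (auto simp: a_def t_def)
  then have returned: "y m \<in> H (Suc a)"
    using H_closed[OF yH(1), of "y m" "Suc a"] yV E_sym[OF yy] by simp
  \<comment> \<open>Otherwise the arrival \<open>y b\<close> before \<open>y m\<close> is also a
    neighbour of \<open>y m\<close> in the other part, hence lies in \<open>H a\<close>, against the
    choice of \<open>N\<close>.\<close>
  have "m = 0"
  proof (cases m)
    case (Suc b)
    have yb: "y b \<noteq> y m" "E (y m) (y b)"
      using ne[of b] H_adj[OF yH(2) yH(1), of b] Suc by auto
    have "d m (y b) = d b (y b)"
      using unmoved[of "y b" b] yb Suc by simp
    then have db: "d m (y b) = t'"
      using flip2[of b] Suc by (simp add: a_def t'_def)
    have "y b \<noteq> y a"
      using db H_side[OF yam(2)] t by (auto simp: t_def)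
    then have dab: "d a (y b) = t'"
      using db unmoved[of "y b" m] by (simp add: a_def)
    have "y b = v \<or> E v (y b)"
      using low_nbrs_clique[OF opt hotH yH(1) low t(2), of m v "y b"] t yb db yv
        ma[OF v(1,2)] HV[OF v(1)] yV
      by (auto simp: t_def)
    then have "y b \<in> H a"
      using H_closed[OF v(1) yV, of b] v(1) dab H_side[OF v(1)] by (auto simp: t'_def)
    then show ?thesis
      using N(2)[OF aN, of b] Suc by (simp add: a_def)
  qed simp
  then show ?thesis
    using returned by (simp add: a_def H_def)
qed

text \<open>Run the walk with \<open>z\<close> as initial arrival, then \<open>x\<close>, then
  \<open>w\<close>, and continue arbitrarily. By \<open>walk_returns\<close>, \<open>z\<close> lies
  in the hot clique of \<open>w\<close> after the second move.\<close>

lemma low_returns: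
  assumes c: "optimal c" "hot c A" and z: "z \<in> A" "low z" and x: "x \<in> A" "low x" "x \<noteq> z"
    and j: "j \<le> k" "j \<noteq> c x" and w: "w \<in> closed_nbhd (c(x := j)) x" "low w" "w \<noteq> x"
  shows "E w z"
proof -
  define i where "i = c z"
  have A: "A = closed_nbhd c z"
    using hot_eq_closed_nbhd[OF c z(1)] .
  have i: "c x = i" "i \<le> k" "i \<noteq> j"
    using c z x j by (auto simp: hot_def i_def)
  define c1 where "c1 = c(x := j)"
  define inv where "inv = (\<lambda>(d, y). optimal d \<and> hot d (closed_nbhd d y) \<and> low y \<and> d y \<in> {i, j})"
  define stp where "stp = (\<lambda>(d, y) (d', y'). y' \<in> closed_nbhd d y \<and> low y' \<and> y' \<noteq> y \<and>
    d' = d(y' := (if d y = i then j else i)))"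
  have inv_step: "inv s'" if "inv s" "stp s s'" for s s'
  proof -
    obtain d y d' y' where s: "s = (d, y)" "s' = (d', y')"
      by (metis surj_pair)
    let ?t = "if d y = i then j else i"
    have st: "optimal d" "hot d (closed_nbhd d y)" "y' \<in> closed_nbhd d y" "low y'" "d' = d(y' := ?t)"
      using that by (auto simp: s inv_def stp_def)
    have "?t \<le> k" "?t \<noteq> d y'"
      using st(3) i j by (auto simp: mem_closed_nbhd)
    then show ?thesis
      using move[OF st(1-4), of ?t] st(4,5) by (auto simp: s inv_def)
  qed
  have ex_step: "\<exists>s'. stp s s'" if "inv s" for s
    using that hot_other_low by (fastforce simp: inv_def stp_def)
  let ?s0 = "(c, z)" and ?s1 = "(c1, x)" and ?s2 = "(c1(w := i), w)"
  have s0: "inv ?s0"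
    using c z A by (simp add: inv_def i_def)
  have s01: "stp ?s0 ?s1"
    using x A i by (simp add: stp_def c1_def i_def)
  have s12: "stp ?s1 ?s2"
    using w i by (simp add: stp_def c1_def)
  let ?P = "\<lambda>(n::nat) s. inv s \<and> (n = 0 \<longrightarrow> s = ?s0) \<and> (n = 1 \<longrightarrow> s = ?s1) \<and> (n = 2 \<longrightarrow> s = ?s2)"
  have "\<exists>f. \<forall>n. ?P n (f n) \<and> stp (f n) (f (Suc n))"
  proof (rule dependent_nat_choice)
    show "\<exists>s. ?P 0 s"
      using s0 by auto
    show "\<exists>s'. ?P (Suc n) s' \<and> stp s s'" if s: "?P n s" for s n
    proof -
      consider "n = 0" | "n = 1" | "n > 1" by linarith
      then show ?thesis
      proof cases
        case 1
        then show ?thesis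
          using s s01 inv_step by (intro exI[of _ ?s1]) auto
      next
        case 2
        then show ?thesis
          using s s12 inv_step by (intro exI[of _ ?s2]) auto
      next
        case 3
        obtain s' where "stp s s'"
          using ex_step s by blast
        then show ?thesis
          using s inv_step[of s s'] 3 by (intro exI[of _ s']) auto
      qed
    qed
  qed
  then obtain f where f: "\<And>n. ?P n (f n)" "\<And>n. stp (f n) (f (Suc n))"
    by blast
  have "snd (f 0) \<in> closed_nbhd (fst (f (Suc (Suc 0)))) (snd (f (Suc (Suc 0))))"
  proof (rule walk_returns[of i j "\<lambda>n. fst (f n)" "\<lambda>n. snd (f n)"])
    fix n
    have "inv (f n)" "stp (f n) (f (Suc n))"
      using f by blast+
    then show "optimal (fst (f n))" "hot (fst (f n)) (closed_nbhd (fst (f n)) (snd (f n)))"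
      "low (snd (f n))" "fst (f n) (snd (f n)) \<in> {i, j}"
      "snd (f (Suc n)) \<in> closed_nbhd (fst (f n)) (snd (f n))" "snd (f (Suc n)) \<noteq> snd (f n)"
      "fst (f (Suc n)) = (fst (f n))(snd (f (Suc n)) := (if fst (f n) (snd (f n)) = i then j else i))"
      by (auto simp: inv_def stp_def split: prod.splits)
  qed (use i j in auto)
  then have "z \<in> closed_nbhd (c1(w := i)) w"
    using f(1)[of 0] f(1)[of 2] by (simp add: numeral_2_eq_2)
  moreover have "c1 w = j" "c1 z = i"
    using w(1) x(3) i by (auto simp: mem_closed_nbhd c1_def i_def)
  ultimately show ?thesis
    using i(3) by (auto simp: mem_closed_nbhd)
qed

text \<open>Two low vertices are handled by \<open>low_returns\<close>. A high one is reached
  through a low vertex of its own clique, since neighbours in another part form a component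
  there.\<close>

lemma hot_join:
  assumes c: "optimal c" "hot c A" and x: "x \<in> A" "low x" and j: "j \<le> k" "j \<noteq> c x"
    and w: "w \<in> V" "c w = j" "E x w" and z: "z \<in> A" and lo: "low z \<or> low w"
  shows "E z w"
proof -
  let ?c1 = "c(x := j)"
  note m = move[OF c x j]
  have A: "c u = c x" "u \<in> V" if "u \<in> A" for u
    using c(2) x(1) that by (auto simp: hot_def)
  have W: "w \<in> closed_nbhd ?c1 x" "w \<noteq> x"
    using w E_irrefl by (auto simp: mem_closed_nbhd)
  have both: "E u v" if "u \<in> A" "low u" "v \<in> closed_nbhd ?c1 x" "low v" "v \<noteq> x" for u v
  proof (cases "u = x")
    case True
    then show ?thesis
      using that by (auto simp: mem_closed_nbhd)
  next
    case False
    then show ?thesis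
      using low_returns[OF c that(1,2) x False[symmetric] j that(3-5)] E_sym by blast
  qed
  have clA: "clique E A" and clW: "clique E (closed_nbhd ?c1 x)"
    using c(2) m(2) by (auto simp: hot_def)
  show ?thesis
  proof (cases "low w")
    case True
    obtain u where u: "u \<in> A" "low u" "u \<noteq> x"
      using hot_other_low[OF c(2)] by blast
    have "E w u"
      using both[OF u(1,2) W(1) True W(2)] E_sym by blast
    moreover have "?c1 w = j" 
      using w W by simp
    ultimately have "E w z" if "z \<noteq> x" "z \<noteq> u"
      using low_nbrs_closed[OF m W(1) True, of "c x" u z] u A[OF u(1)] A[OF z] that z j
        cliqueD[OF clA u(1) z] c(1) A(1)[OF x(1)] A(2)[OF x(1)]
      by (auto simp: optimal_def is_partition_def)
    then show ?thesis
      using \<open>E w u\<close> w(3) E_sym by blast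
  next
    case False
    then have z_low: "low z"
      using lo by blast
    obtain u where u: "u \<in> closed_nbhd ?c1 x" "low u" "u \<noteq> x"
      using hot_other_low[OF m(2)] by blast
    have "E z u" "E u w"
      using both[OF z z_low u] cliqueD[OF clW u(1) W(1)] u(2) False by auto
    moreover have "c u = j" "u \<in> V"
      using u by (auto simp: mem_closed_nbhd)
    ultimately show ?thesis
      using low_nbrs_closed[OF c z z_low j(1)] j(2) A(1)[OF z] w by metis
  qed
qed

text \<open>Vertices in one part lie in a common clique; if one of them is in the part of
  \<open>x\<close>, \<open>hot_join\<close> applies. The alternative \<open>c u = c v\<close> later
  bounds the number of high vertices.\<close>

lemma nbhd_adjacent:
  assumes c: "optimal c" "hot c A" and x: "x \<in> A" "low x"
    and uv: "u \<in> insert x (nbrs E V x)" "v \<in> insert x (nbrs E V x)" "u \<noteq> v"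
    and lo: "low u \<or> low v \<or> c u = c v"
  shows "E u v"
proof -
  have part_le: "c v \<le> k" if "v \<in> V" for v
    using c(1) that by (simp add: optimal_def is_partition_def)
  have A: "a \<in> A" if "a \<in> insert x (nbrs E V x)" "c a = c x" for a
    using hot_eq_closed_nbhd[OF c x(1)] that by (auto simp: mem_closed_nbhd)
  have clA: "clique E A"
    using c(2) by (simp add: hot_def)
  have cA: "c a = c x" if "a \<in> A" for a
    using c(2) x(1) that by (auto simp: hot_def)
  have one: "E u v" if "u \<in> A" "v \<in> insert x (nbrs E V x)" "c v \<noteq> c x" "low u \<or> low v" for u v
    using hot_join[OF c x, of "c v" v u] that part_le by auto
  show ?thesis
  proof (cases "c u = c x \<or> c v = c x")
    case True
    show ?thesis
    proof (cases "c u = c v")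
      case True
      then show ?thesis
        using A uv cliqueD[OF clA] \<open>c u = c x \<or> c v = c x\<close> by metis
    next
      case False
      then show ?thesis
        using one[OF A[OF uv(1)] uv(2)] one[OF A[OF uv(2)] uv(1)] lo True E_sym by metis
    qed
  next
    case False
    then have V: "u \<in> V" "v \<in> V" "E x u" "E x v"
      using uv by auto
    show ?thesis
    proof (cases "c u = c v")
      case True
      then show ?thesis
        using low_nbrs_clique[OF c x part_le[OF V(1)]] False V uv(3) by metis
    next
      case ne: False
      \<comment> \<open>Moving \<open>x\<close> to the part of \<open>u\<close> puts
        \<open>u\<close> into the hot clique of \<open>x\<close>, which reduces to
        \<open>hot_join\<close>.\<close>
      let ?c1 = "c(x := c u)"
      have m: "optimal ?c1" "hot ?c1 (closed_nbhd ?c1 x)"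
        using move[OF c x part_le[OF V(1)]] False by auto
      have "u \<in> closed_nbhd ?c1 x" "v \<noteq> x"
        using V E_irrefl by (auto simp: mem_closed_nbhd)
      then show ?thesis
        using hot_join[OF m self_closed_nbhd x(2) part_le[OF V(2)], of v u] ne False V lo by auto
    qed
  qed
qed

text \<open>Two high vertices in the closed neighbourhood of a low vertex of a hot clique have few
  neighbours outside it, so they could be given the same colour.\<close>

lemma complete:
  assumes "4 * k < r"
  shows "clique E V" "card V = r + 1"
proof -
  obtain c A where c: "optimal c" "hot c A"
    using ex_optimal ex_hot by blast
  obtain x where x: "x \<in> A" "low x"
    using hot_other_low[OF c(2)] by blast
  define X where "X = insert x (nbrs E V x)"
  define Y where "Y = {y \<in> X. \<not> low y}"
  define L where "L = X - Y"
  have X: "X \<subseteq> V" "x \<in> X" "finite X" "finite Y" "finite L"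
    using x fin by (auto simp: X_def Y_def L_def low_def)
  have card_X: "card X = r + 1"
    using x fin by (simp add: X_def low_def E_irrefl)
  have adj: "E u v" if "u \<in> X" "v \<in> X" "u \<noteq> v" "low u \<or> low v \<or> c u = c v" for u v
    using nbhd_adjacent[OF c x, of u v] that unfolding X_def by blast
  have high: "u = v" if "u \<in> Y" "v \<in> Y" for u v
  proof (rule ccontr)
    assume "u \<noteq> v"
    have indep: "\<not> E a b" if "a \<in> Y" "b \<in> Y" for a b
      using adjacent_low X(1) that by (auto simp: Y_def)
    \<comment> \<open>Distinct vertices of \<open>X\<close> in the same part are adjacent, whereas
      \<open>Y\<close> is independent.\<close>
    have "inj_on c Y"
      using indep adj by (force simp: inj_on_def Y_def)
    moreover have "c ` Y \<subseteq> {..k}"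
      using c(1) X(1) by (auto simp: Y_def optimal_def is_partition_def)
    ultimately have card_Y: "card Y \<le> k + 1"
      using card_inj_on_le[of c Y "{..k}"] by simp
    have card_L: "card L + card Y = r + 1"
      using card_X X card_mono[of X Y] by (simp add: L_def Y_def card_Diff_subset)
    let ?out = "nbrs E (V - X)"
    \<comment> \<open>Each \<open>y\<close> is adjacent to all of \<open>L\<close>, which has at
      least \<open>r - k\<close> vertices, and has degree at most \<open>r + k\<close>.\<close>
    have card_out: "card (?out y) \<le> 2 * k" if y: "y \<in> Y" for y
    proof -
      have "E y l" if "l \<in> L" for l
        using that y adj[of y l] by (auto simp: L_def Y_def)
      then have "card (?out y \<union> L) \<le> card (nbrs E V y)"
        using fin X(1) by (intro card_mono) (auto simp: L_def)
      moreover have "card (?out y \<union> L) = card (?out y) + card L"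
        using fin X by (intro card_Un_disjoint) (auto simp: L_def)
      moreover have "card (nbrs E V y) \<le> r + k"
        using degree_le y X(1) by (auto simp: Y_def)
      ultimately show ?thesis
        using card_L card_Y by linarith
    qed
    have L_nbrs: "v \<in> X" if l: "l \<in> L" and v: "v \<in> V" "E l v" for l v
    proof -
      have "low l"
        using l by (simp add: L_def Y_def)
      moreover have "E l s" if "s \<in> X" "s \<noteq> l" for s
        using that l adj[of l s] by (auto simp: L_def Y_def)
      then have "X - {l} \<subseteq> nbrs E V l"
        using X(1) by (simp add: subset_iff)
      moreover have "card (X - {l}) = r"
        using card_X l X by (simp add: L_def)
      ultimately have "X - {l} = nbrs E V l"
        using fin by (intro card_seteq) (auto simp: low_def)
      moreover have "v \<in> nbrs E V l"
        using v by simp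
      ultimately show ?thesis
        by blast
    qed
    obtain f where "colouring (V - {x}) E r f"
      using vertex_deleted X by blast
    then have f: "colouring (V - X) E r f"
      by (rule colouring_subset) (use X in auto)
    have free: "\<exists>a<r. a \<notin> f ` S" if "card S < r" "finite S" for S
    proof -
      have "\<not> {..<r} \<subseteq> f ` S"
        using that card_mono[of "f ` S" "{..<r}"] card_image_le[of S f] by auto
      then show ?thesis by auto
    qed
    \<comment> \<open>Together \<open>u\<close> and \<open>v\<close> see at most
      \<open>4 * k\<close> vertices outside \<open>X\<close>, so a common colour \<open>a\<close> is
      free for both.\<close>
    have "card (?out u \<union> ?out v) \<le> card (?out u) + card (?out v)"
      by (rule card_Un_le)
    also have "\<dots> < r"
      using assms card_out[of u] card_out[of v] \<open>u \<in> Y\<close> \<open>v \<in> Y\<close> by linarith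
    finally obtain a where a: "a < r" "a \<notin> f ` (?out u \<union> ?out v)"
      using free[of "?out u \<union> ?out v"] fin by auto
    have "\<exists>b<r. b \<notin> f ` ?out y" if "y \<in> Y" for y
      using card_out[OF that] assms fin by (intro free) auto
    then obtain b where b: "\<And>y. y \<in> Y \<Longrightarrow> b y < r \<and> b y \<notin> f ` ?out y"
      by metis
    define g where "g = b(u := a, v := a)"
    have g: "g y < r" "g y \<notin> f ` ?out y" if "y \<in> Y" for y
      using a b that by (auto simp: g_def)
    have "\<not> inj_on g Y"
      using \<open>u \<in> Y\<close> \<open>v \<in> Y\<close> \<open>u \<noteq> v\<close> by (auto simp: g_def inj_on_def)
    then have "card (g ` Y) < card Y"
      using X by (meson card_image_le eq_card_imp_inj_on nat_less_le)
    moreover have "card ({..<r} - g ` Y) = r - card (g ` Y)"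
      using X g by (subst card_Diff_subset) auto
    \<comment> \<open>The repeated colour on \<open>Y\<close> leaves at least
      \<open>r + 1 - card Y\<close> colours, just enough to colour \<open>L\<close> injectively; by
      \<open>L_nbrs\<close> the colours outside \<open>X\<close> do not matter for
      \<open>L\<close>.\<close>
    ultimately have "card L \<le> card ({..<r} - g ` Y)"
      using card_L by linarith
    then obtain h where h: "h ` L \<subseteq> {..<r} - g ` Y" "inj_on h L"
      using card_le_inj[of L "{..<r} - g ` Y"] X by auto
    define F where "F z = (if z \<in> Y then g z else if z \<in> L then h z else f z)" for z
    have XYL: "z \<in> X \<longleftrightarrow> z \<in> Y \<or> z \<in> L" "\<not> (z \<in> Y \<and> z \<in> L)" for z
      by (auto simp: L_def Y_def)
    have Y_ne: "F p \<noteq> F s" if "p \<in> Y" "s \<in> V" "E p s" for p s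
      using that indep g[OF that(1)] h(1) XYL[of s] by (auto simp: F_def)
    have L_ne: "F p \<noteq> F s" if "p \<in> L" "s \<in> L" "E p s" for p s
      using that h(2) XYL E_irrefl by (auto simp: F_def inj_on_def)
    have "colouring V E r F"
      unfolding colouring_def
    proof (intro conjI ballI impI)
      show "F p < r" if "p \<in> V" for p
        using that f g h(1) XYL[of p] by (auto simp: F_def colouring_def)
      show "F p \<noteq> F s" if ps: "p \<in> V" "s \<in> V" "E p s" for p s
      proof (cases "p \<in> Y \<or> s \<in> Y")
        case True
        then show ?thesis
          using Y_ne ps E_sym by metis
      next
        case False
        then show ?thesis
          using L_ne[of p s] L_nbrs[of p s] L_nbrs[of s p] ps E_sym f XYL[of p] XYL[of s]
          by (auto simp: F_def colouring_def)
      qed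
    qed
    then show False
      using not_colourable by blast
  qed
  have cl: "clique E X"
    using adj high by (auto simp: clique_def Y_def)
  \<comment> \<open>Deleting a vertex outside \<open>X\<close> would leave a clique on
    \<open>r + 1\<close> vertices coloured with \<open>r\<close> colours.\<close>
  have "V \<subseteq> X"
  proof
    fix v assume v: "v \<in> V"
    show "v \<in> X"
    proof (rule ccontr)
      assume "v \<notin> X"
      obtain f where "colouring (V - {v}) E r f"
        using vertex_deleted v by blast
      then have f: "colouring X E r f"
        by (rule colouring_subset) (use X \<open>v \<notin> X\<close> in auto)
      then have "inj_on f X" "f ` X \<subseteq> {..<r}"
        using cl unfolding colouring_def clique_def inj_on_def by (blast, auto)
      then show False
        using card_inj_on_le[of f X "{..<r}"] card_X by simp
    qed
  qed
  then show "clique E V" "card V = r + 1"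
    using X(1) cl card_X by auto
qed

end

section \<open>From the graph hypotheses to the locale\<close>

lemma ex_colouring_chromatic_number:
  assumes "finite V" "\<And>v. \<not> E v v"
  shows "\<exists>f. colouring V E (chromatic_number V E) f"
proof -
  obtain f n where "f ` V = {i::nat. i < n}" "inj_on f V"
    using finite_imp_inj_to_nat_seg[OF assms(1)] by blast
  then have "colouring V E n f"
    using assms(2) by (fastforce simp: colouring_def inj_on_def)
  then show ?thesis
    unfolding chromatic_number_def by (intro LeastI[of "\<lambda>k. \<exists>f. colouring V E k f" n]) blast
qed

theorem theorem3p5:
  fixes V :: "'a set" and E :: "'a \<Rightarrow> 'a \<Rightarrow> bool" and k :: int
  assumes "k \<ge> 2"
    and "simple_graph V E"
    and "vertex_critical V E"
    and "int (chromatic_number V E) \<ge> int (max_degree V E) + 1 - k"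
    and "int (max_degree V E) + 1 \<ge> 6 * k"
    and "edgeless_on (high_vertices V E (chromatic_number V E)) E"
  shows "is_complete_graph V E (chromatic_number V E)"
proof -
  define K where "K = nat k"
  define r where "r = chromatic_number V E - 1"
  have K: "K \<ge> 2" "max_degree V E \<le> r + K" "5 * K \<le> r + 1" "chromatic_number V E = r + 1"
    using assms(1,4,5) by (auto simp: K_def r_def)
  \<comment> \<open>Part 0 takes what the other \<open>K\<close> parts leave; since
    \<open>5 * K \<le> r + 1\<close> and \<open>K \<ge> 2\<close>, the remainder is at least
    \<open>2 * K - 1\<close>, hence at least 3.\<close>
  define q where "q i = (if i = 0 then r - 3 * K else 3)" for i :: nat
  have degree: "degree V E v = card (nbrs E V v)" for v
    by (simp add: degree_def nbrs_def)
  have fin: "finite V"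
    using assms(2) by (simp add: simple_graph_def)
  interpret critical_partition E V r K q
  proof
    show sym: "E v u" if "E u v" for u v
      using assms(2) that by (auto simp: simple_graph_def)
    show irrefl: "\<not> E v v" for v
      using assms(2) by (auto simp: simple_graph_def)
    show "finite V" by (fact fin)
    show "\<not> colouring V E r f" for f
      using not_less_Least[of r "\<lambda>k. \<exists>f. colouring V E k f"] K(4)
      by (auto simp: chromatic_number_def)
    show "\<exists>f. colouring (V - {v}) E r f" if "v \<in> V" for v
    proof -
      have "chromatic_number (V - {v}) E \<le> r"
        using assms(3) that K(4) by (fastforce simp: vertex_critical_def)
      then show ?thesis
        using ex_colouring_chromatic_number[of "V - {v}" E] fin irrefl
        unfolding colouring_def by (meson finite_Diff order_less_le_trans)
    qed
    show "card (nbrs E V v) \<le> r + K" if "v \<in> V" for v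
    proof -
      have "degree V E v \<le> max_degree V E"
        using fin that by (auto simp: max_degree_def intro!: Max_ge)
      then show ?thesis
        using K(2) degree by simp
    qed
    show "card (nbrs E V u) \<le> r \<or> card (nbrs E V v) \<le> r" if "u \<in> V" "v \<in> V" "E u v" for u v
      using assms(6) that K(4) by (force simp: edgeless_on_def high_vertices_def degree)
    show "3 \<le> q i" if "i \<le> K" for i
      using K by (auto simp: q_def)
    have "{..K} = insert 0 {1..K}"
      by auto
    then have "(\<Sum>i\<le>K. q i) = q 0 + (\<Sum>i=1..K. q i)"
      by simp
    also have "(\<Sum>i=1..K. q i) = 3 * K"
      by (simp add: q_def)
    finally show "(\<Sum>i\<le>K. q i) = r"
      using K by (simp add: q_def)
  qed
  have "4 * K < r"
    using K by linarith
  from complete[OF this] show ?thesis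
    using K(4) by (simp add: is_complete_graph_def clique_def)
qed

end
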